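(* Let $\mathscr{R}$ be the set of inference rules consisting of axiom, symmetric cut, and split. Let $\mathscr{H}$ be a set of formulas (the hypotheses) and let $A$ be a formula (the goal). If there is a circular proof of $A$ from $\mathscr{H}$ through the rules in $\mathscr{R}$, then every truth assignment that satisfies every formula in $\mathscr{H}$ also satisfies $A$.
   Context: Formulas. A literal is a propositional variable $X$ or its negation $\overline{X}$. Formulas are in negation normal form: built from literals by disjunction and conjunction. Both $\vee$ and $\wedge$ are treated as associative, commutative and idempotent (i.e. as operations on finite sets of formulas); the empty disjunction $0$ is always false and neutral for $\vee$, and the empty conjunction $1$ is always true and neutral for $\wedge$. The dual $\overline{A}$ of $A$ is defined by: $\overline{A}$ is the complementary literal if $A$ is a literal, $\overline{B\vee C}=\overline{B}\wedge\overline{C}$, $\overline{B\wedge C}=\overline{B}\vee\overline{C}$ (so $\overline{0}=1$). Truth assignments evaluate formulas as usual. Rules, for arbitrary formulas $A,C$: axiom (no premises, conclusion $A\vee\overline{A}$); symmetric cut (premises $C\vee A$ and $C\vee\overline{A}$, conclusion $C$); split (premise $C$, two conclusions $C\vee A$ and $C\vee\overline{A}$). Circular proofs. A circular pre-proof $\Pi$ over a set of inference rules is a finite directed bipartite graph $G(\Pi)$ with two types of vertices, formula-vertices (set $J$) and inference-vertices (set $I$), every edge going between the two types. Each formula-vertex is labelled by a formula (different vertices may carry the same formula). Each inference-vertex is labelled by an instance of a rule whose premises are the formulas labelling its in-neighbours and whose conclusions are the formulas labelling its out-neighbours (one in-neighbour per premise, one out-neighbour per conclusion). Cycles are allowed.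 $N^-(u)$ and $N^+(u)$ denote the sets of in- and out-neighbours of $u$. A flow assignment is a map $F:I\to\mathbb{R}^+$ to the positive reals. The balance of $u\in J$ is $B(u)=\sum_{w\in N^-(u)}F(w)-\sum_{w\in N^+(u)}F(w)$. Formula-vertices with $B(u)<0$ are sources of $G(\Pi,F)$ and those with $B(u)>0$ are sinks. $F$ witnesses a proof of $A$ from $\mathscr{H}$ if every source is labelled by a formula in $\mathscr{H}$ and some sink is labelled by $A$. A circular proof of $A$ from $\mathscr{H}$ is a circular pre-proof for which there exists a flow assignment witnessing a proof of $A$ from $\mathscr{H}$. *)

theory Defs
  imports Complex_Main "HOL-Library.Multiset" "Graph_Theory.Pair_Digraph"
begin

section \<open>Formulas\<close>

datatype 'v literal = Pos 'v | Neg 'v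

datatype 'v raw_formula =
    RLit "'v literal"
  | RFalsum
  | RVerum
  | ROr "'v raw_formula" "'v raw_formula"
  | RAnd "'v raw_formula" "'v raw_formula"

text \<open>The congruence identifying formulas up to associativity, commutativity and idempotence of
  both connectives and neutrality of the empty disjunction and the empty conjunction. Nothing else
  is identified: there is no distributivity, absorption or annihilation.\<close>

inductive aci :: "'v raw_formula \<Rightarrow> 'v raw_formula \<Rightarrow> bool" where
  aci_refl: "aci A A"
| aci_sym: "aci A B \<Longrightarrow> aci B A"
| aci_trans: "aci A B \<Longrightarrow> aci B C \<Longrightarrow> aci A C"
| aci_or_cong: "aci A A' \<Longrightarrow> aci B B' \<Longrightarrow> aci (ROr A B) (ROr A' B')"
| aci_and_cong: "aci A A' \<Longrightarrow> aci B B' \<Longrightarrow> aci (RAnd A B) (RAnd A' B')"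
| aci_or_assoc: "aci (ROr (ROr A B) C) (ROr A (ROr B C))"
| aci_or_comm: "aci (ROr A B) (ROr B A)"
| aci_or_idem: "aci (ROr A A) A"
| aci_or_neutral: "aci (ROr A RFalsum) A"
| aci_and_assoc: "aci (RAnd (RAnd A B) C) (RAnd A (RAnd B C))"
| aci_and_comm: "aci (RAnd A B) (RAnd B A)"
| aci_and_idem: "aci (RAnd A A) A"
| aci_and_neutral: "aci (RAnd A RVerum) A"

quotient_type 'v formula = "'v raw_formula" / aci
  proof (rule equivpI)
  show "reflp aci" by (rule reflpI) (rule aci_refl)
  show "symp aci" by (rule sympI) (rule aci_sym)
  show "transp aci" by (rule transpI) (rule aci_trans)
qed

lift_definition Lit :: "'v literal \<Rightarrow> 'v formula" is RLit .

lift_definition Falsum :: "'v formula" is RFalsum .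

lift_definition Verum :: "'v formula" is RVerum .

lift_definition Or :: "'v formula \<Rightarrow> 'v formula \<Rightarrow> 'v formula" (infixr "\<^bold>\<or>" 65) is ROr
  by (rule aci_or_cong)

lift_definition And :: "'v formula \<Rightarrow> 'v formula \<Rightarrow> 'v formula" (infixr "\<^bold>\<and>" 70) is RAnd
  by (rule aci_and_cong)

fun literal_dual :: "'v literal \<Rightarrow> 'v literal" where
  "literal_dual (Pos x) = Neg x"
| "literal_dual (Neg x) = Pos x"

primrec raw_dual :: "'v raw_formula \<Rightarrow> 'v raw_formula" where
  "raw_dual (RLit l) = RLit (literal_dual l)"
| "raw_dual RFalsum = RVerum"
| "raw_dual RVerum = RFalsum"
| "raw_dual (ROr A B) = RAnd (raw_dual A) (raw_dual B)"
| "raw_dual (RAnd A B) = ROr (raw_dual A) (raw_dual B)"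

lift_definition dual :: "'v formula \<Rightarrow> 'v formula" is raw_dual
proof -
  fix A B :: "'v raw_formula"
  assume "aci A B"
  then show "aci (raw_dual A) (raw_dual B)"
  proof (induction rule: aci.induct)
    case (aci_sym A B)
    from aci_sym.IH show ?case by (rule aci.aci_sym)
  next
    case (aci_trans A B C)
    from aci_trans.IH show ?case by (rule aci.aci_trans)
  qed (unfold raw_dual.simps,
      (rule aci.aci_refl | rule aci.aci_or_assoc | rule aci.aci_and_assoc
        | rule aci.aci_or_comm | rule aci.aci_and_comm | rule aci.aci_or_idem | rule aci.aci_and_idem
        | rule aci.aci_or_neutral | rule aci.aci_and_neutral
        | (rule aci.aci_or_cong, assumption, assumption)
        | (rule aci.aci_and_cong, assumption, assumption))+)
qed

fun literal_holds :: "('v \<Rightarrow> bool) \<Rightarrow> 'v literal \<Rightarrow> bool" where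
  "literal_holds \<alpha> (Pos x) = \<alpha> x"
| "literal_holds \<alpha> (Neg x) = (\<not> \<alpha> x)"

primrec raw_satisfies :: "('v \<Rightarrow> bool) \<Rightarrow> 'v raw_formula \<Rightarrow> bool" where
  "raw_satisfies \<alpha> (RLit l) = literal_holds \<alpha> l"
| "raw_satisfies \<alpha> RFalsum = False"
| "raw_satisfies \<alpha> RVerum = True"
| "raw_satisfies \<alpha> (ROr A B) = (raw_satisfies \<alpha> A \<or> raw_satisfies \<alpha> B)"
| "raw_satisfies \<alpha> (RAnd A B) = (raw_satisfies \<alpha> A \<and> raw_satisfies \<alpha> B)"

lift_definition satisfies :: "('v \<Rightarrow> bool) \<Rightarrow> 'v formula \<Rightarrow> bool" is raw_satisfies
proof -
  fix \<alpha> :: "'v \<Rightarrow> bool" and A B :: "'v raw_formula"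
  assume "aci A B"
  then show "raw_satisfies \<alpha> A = raw_satisfies \<alpha> B"
    by induction auto
qed

lemma Or_ac:
  "(A \<^bold>\<or> B) \<^bold>\<or> C = A \<^bold>\<or> (B \<^bold>\<or> C)" "A \<^bold>\<or> B = B \<^bold>\<or> A" "A \<^bold>\<or> A = A" "A \<^bold>\<or> Falsum = A"
  by (transfer, rule aci_or_assoc aci_or_comm aci_or_idem aci_or_neutral)+

lemma And_ac:
  "(A \<^bold>\<and> B) \<^bold>\<and> C = A \<^bold>\<and> (B \<^bold>\<and> C)" "A \<^bold>\<and> B = B \<^bold>\<and> A" "A \<^bold>\<and> A = A" "A \<^bold>\<and> Verum = A"
  by (transfer, rule aci_and_assoc aci_and_comm aci_and_idem aci_and_neutral)+

lemma dual_simps [simp]: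
  "dual (Lit l) = Lit (literal_dual l)"
  "dual Falsum = Verum"
  "dual Verum = Falsum"
  "dual (A \<^bold>\<or> B) = dual A \<^bold>\<and> dual B"
  "dual (A \<^bold>\<and> B) = dual A \<^bold>\<or> dual B"
  by (transfer, simp add: aci_refl)+

lemma satisfies_simps [simp]:
  "satisfies \<alpha> (Lit l) = literal_holds \<alpha> l"
  "\<not> satisfies \<alpha> Falsum"
  "satisfies \<alpha> Verum"
  "satisfies \<alpha> (A \<^bold>\<or> B) = (satisfies \<alpha> A \<or> satisfies \<alpha> B)"
  "satisfies \<alpha> (A \<^bold>\<and> B) = (satisfies \<alpha> A \<and> satisfies \<alpha> B)"
  by (transfer, simp)+


section \<open>Inference rules\<close>

text \<open>Multisets are needed because two premises, or two conclusions, of one instance may be the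
  same formula, for instance \<open>C \<^bold>\<or> A = C \<^bold>\<or> dual A\<close> when both \<open>A\<close> and \<open>dual A\<close> are disjuncts of \<open>C\<close>.\<close>

datatype 'v inference =
  Inference (prems_of: "'v formula multiset") (concls_of: "'v formula multiset")

text \<open>A rule is the set of its instances.\<close>

type_synonym 'v rule = "'v inference set"

definition axiom_rule :: "'v rule" where
  "axiom_rule = {Inference {#} {#A \<^bold>\<or> dual A#} | A. True}"

definition symmetric_cut_rule :: "'v rule" where
  "symmetric_cut_rule = {Inference {#C \<^bold>\<or> A, C \<^bold>\<or> dual A#} {#C#} | A C. True}"

definition split_rule :: "'v rule" where
  "split_rule = {Inference {#C#} {#C \<^bold>\<or> A, C \<^bold>\<or> dual A#} | A C. True}"


section \<open>Circular proofs\<close>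

record ('u, 'v) labelled_graph =
  graph :: "'u pair_pre_digraph"
  formula_verts :: "'u set"
  inference_verts :: "'u set"
  formula_label :: "'u \<Rightarrow> 'v formula"
  inference_label :: "'u \<Rightarrow> 'v inference"

definition in_nbrs :: "('u, 'v) labelled_graph \<Rightarrow> 'u \<Rightarrow> 'u set" where
  "in_nbrs P u = {w. (w, u) \<in> parcs (graph P)}"

definition out_nbrs :: "('u, 'v) labelled_graph \<Rightarrow> 'u \<Rightarrow> 'u set" where
  "out_nbrs P u = {w. (u, w) \<in> parcs (graph P)}"

text \<open>The multiset equations say that the in-neighbours (out-neighbours) of an inference-vertex
  are in label-preserving bijection with the premises (conclusions) of its label.\<close>

definition circular_pre_proof :: "'v rule set \<Rightarrow> ('u, 'v) labelled_graph \<Rightarrow> bool" where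
  "circular_pre_proof \<R> P \<longleftrightarrow>
     pair_fin_digraph (graph P) \<and>
     pverts (graph P) = formula_verts P \<union> inference_verts P \<and>
     formula_verts P \<inter> inference_verts P = {} \<and>
     parcs (graph P) \<subseteq>
       formula_verts P \<times> inference_verts P \<union> inference_verts P \<times> formula_verts P \<and>
     (\<forall>w \<in> inference_verts P.
        (\<exists>R \<in> \<R>. inference_label P w \<in> R) \<and>
        prems_of (inference_label P w) =
          image_mset (formula_label P) (mset_set (in_nbrs P w)) \<and>
        concls_of (inference_label P w) =
          image_mset (formula_label P) (mset_set (out_nbrs P w)))"

text \<open>Only the values of a flow on the inference-vertices are relevant.\<close>

definition flow_assignment :: "('u, 'v) labelled_graph \<Rightarrow> ('u \<Rightarrow> real) \<Rightarrow> bool" where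
  "flow_assignment P F \<longleftrightarrow> (\<forall>w \<in> inference_verts P. 0 < F w)"

definition balance :: "('u, 'v) labelled_graph \<Rightarrow> ('u \<Rightarrow> real) \<Rightarrow> 'u \<Rightarrow> real" where
  "balance P F u = (\<Sum>w \<in> in_nbrs P u. F w) - (\<Sum>w \<in> out_nbrs P u. F w)"

definition sources :: "('u, 'v) labelled_graph \<Rightarrow> ('u \<Rightarrow> real) \<Rightarrow> 'u set" where
  "sources P F = {u \<in> formula_verts P. balance P F u < 0}"

definition sinks :: "('u, 'v) labelled_graph \<Rightarrow> ('u \<Rightarrow> real) \<Rightarrow> 'u set" where
  "sinks P F = {u \<in> formula_verts P. balance P F u > 0}"

definition witnesses_proof ::
    "('u, 'v) labelled_graph \<Rightarrow> ('u \<Rightarrow> real) \<Rightarrow> 'v formula set \<Rightarrow> 'v formula \<Rightarrow> bool" where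
  "witnesses_proof P F H A \<longleftrightarrow>
     (\<forall>u \<in> sources P F. formula_label P u \<in> H) \<and>
     (\<exists>u \<in> sinks P F. formula_label P u = A)"

definition circular_proof ::
    "'v rule set \<Rightarrow> ('u, 'v) labelled_graph \<Rightarrow> 'v formula set \<Rightarrow> 'v formula \<Rightarrow> bool" where
  "circular_proof \<R> P H A \<longleftrightarrow>
     circular_pre_proof \<R> P \<and> (\<exists>F. flow_assignment P F \<and> witnesses_proof P F H A)"

end

theory Submission
  imports Defs
begin

text \<open>Fix an assignment. In every instance of the three rules the number of falsified premises
  equals the number of falsified conclusions, so the balances of all falsified formula-vertices
  sum to zero. If the hypotheses hold, no falsified vertex is a source; hence no summand is
  negative, all of them vanish, and no falsified vertex is a sink.\<close>

lemma satisfies_dual [simp]: "satisfies \<alpha> (dual A) \<longleftrightarrow> \<not> satisfies \<alpha> A"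
\<comment> \<open>Passing to raw representatives makes structural induction available; the
  connective cases are De Morgan's laws.\<close>
proof transfer
  fix \<alpha> :: "'v \<Rightarrow> bool" and A :: "'v raw_formula"
  have "literal_holds \<alpha> (literal_dual l) \<longleftrightarrow> \<not> literal_holds \<alpha> l" for l
    by (cases l) simp_all
  then show "raw_satisfies \<alpha> (raw_dual A) \<longleftrightarrow> \<not> raw_satisfies \<alpha> A"
    by (induction A) simp_all
qed

definition num_false :: "('v \<Rightarrow> bool) \<Rightarrow> 'v formula multiset \<Rightarrow> nat" where
  "num_false \<alpha> M = size {#B \<in># M. \<not> satisfies \<alpha> B#}"

text \<open>An axiom is a tautology, so both counts are 0. For cut and split, if \<open>C\<close>
  holds then nothing is falsified; if \<open>C\<close> fails, exactly one of its extensions by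
  \<open>A\<close> and by \<open>dual A\<close> fails, which matches the single false
  \<open>C\<close> on the other side.\<close>

lemma num_false_prems_eq_concls:
  assumes "r \<in> axiom_rule \<union> symmetric_cut_rule \<union> split_rule"
  shows "num_false \<alpha> (prems_of r) = num_false \<alpha> (concls_of r)"
  using assms
  by (auto simp: num_false_def axiom_rule_def symmetric_cut_rule_def split_rule_def)

text \<open>Multisets keep multiplicities, so vertices sharing a label are still counted separately
  and \<open>f\<close> may be non-injective. Finiteness matters because \<open>mset_set\<close> of
  an infinite set is empty.\<close>

lemma num_false_image_mset_set:
  assumes "finite S"
  shows "num_false \<alpha> (image_mset f (mset_set S)) = card {u \<in> S. \<not> satisfies \<alpha> (f u)}"
  using assms by (simp add: num_false_def filter_mset_image_mset filter_mset_mset_set)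

text \<open>Double counting of the edges at \<open>J\<close>: grouped by inference-vertex, each edge
  from \<open>w\<close> into \<open>J\<close> contributes \<open>F w\<close> and each edge from
  \<open>J\<close> into \<open>w\<close> contributes \<open>- F w\<close>.\<close>

lemma sum_balance:
  assumes fin: "finite (inference_verts P)" "finite J"
    and inb: "\<And>u. u \<in> J \<Longrightarrow> in_nbrs P u \<subseteq> inference_verts P"
    and outb: "\<And>u. u \<in> J \<Longrightarrow> out_nbrs P u \<subseteq> inference_verts P"
  shows "(\<Sum>u\<in>J. balance P F u) =
    (\<Sum>w\<in>inference_verts P.
      (real (card (out_nbrs P w \<inter> J)) - real (card (in_nbrs P w \<inter> J))) * F w)"
proof -
  let ?I = "inference_verts P"
  \<comment> \<open>Each edge is viewed from its other end, so that the inner range becomes a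
    restriction of the fixed set \<open>?I\<close> and the two sums can be exchanged.\<close>
  have "(\<Sum>u\<in>J. \<Sum>w\<in>in_nbrs P u. F w) = (\<Sum>u\<in>J. \<Sum>w | w \<in> ?I \<and> u \<in> out_nbrs P w. F w)"
    using inb by (intro sum.cong refl) (auto simp: in_nbrs_def out_nbrs_def)
  also have "\<dots> = (\<Sum>w\<in>?I. \<Sum>u | u \<in> J \<and> u \<in> out_nbrs P w. F w)"
    using fin by (intro sum.swap_restrict)
  also have "\<dots> = (\<Sum>w\<in>?I. real (card (out_nbrs P w \<inter> J)) * F w)"
    by (intro sum.cong refl) (simp add: Int_def conj_commute)
  finally have into: "(\<Sum>u\<in>J. \<Sum>w\<in>in_nbrs P u. F w) = \<dots>" .
  have "(\<Sum>u\<in>J. \<Sum>w\<in>out_nbrs P u. F w) = (\<Sum>u\<in>J. \<Sum>w | w \<in> ?I \<and> u \<in> in_nbrs P w. F w)"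
    using outb by (intro sum.cong refl) (auto simp: in_nbrs_def out_nbrs_def)
  also have "\<dots> = (\<Sum>w\<in>?I. \<Sum>u | u \<in> J \<and> u \<in> in_nbrs P w. F w)"
    using fin by (intro sum.swap_restrict)
  also have "\<dots> = (\<Sum>w\<in>?I. real (card (in_nbrs P w \<inter> J)) * F w)"
    by (intro sum.cong refl) (simp add: Int_def conj_commute)
  finally have out: "(\<Sum>u\<in>J. \<Sum>w\<in>out_nbrs P u. F w) = \<dots>" .
  show ?thesis
    by (simp add: balance_def sum_subtractf into out left_diff_distrib)
qed

text \<open>Rule instances preserve the number of falsified formulas, so every coefficient of
  \<open>F w\<close> in \<open>sum_balance\<close> vanishes.\<close>

lemma sum_balance_false_eq_0:
  assumes pre: "circular_pre_proof {axiom_rule, symmetric_cut_rule, split_rule} P"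
    and J: "J = {u \<in> formula_verts P. \<not> satisfies \<alpha> (formula_label P u)}"
  shows "finite J" "(\<Sum>u\<in>J. balance P F u) = 0"
proof -
  let ?I = "inference_verts P"
  from pre interpret pair_fin_digraph "graph P"
    by (simp add: circular_pre_proof_def)
  have verts: "pverts (graph P) = formula_verts P \<union> ?I" "formula_verts P \<inter> ?I = {}"
    and arcs: "parcs (graph P) \<subseteq> formula_verts P \<times> ?I \<union> ?I \<times> formula_verts P"
    using pre by (simp_all add: circular_pre_proof_def)
  have finI: "finite ?I" and finV: "finite (formula_verts P)"
    using pair_finite_verts verts(1) by auto
  then show finJ: "finite J" using J by simp
  \<comment> \<open>Disjointness of the two vertex types excludes the half of the arc relation in
    which \<open>w\<close> would be a formula-vertex.\<close>
  have nbrs: "in_nbrs P w \<subseteq> formula_verts P" "out_nbrs P w \<subseteq> formula_verts P" if "w \<in> ?I" for w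
    using arcs verts(2) that by (auto simp: in_nbrs_def out_nbrs_def)
  have "card (out_nbrs P w \<inter> J) = card (in_nbrs P w \<inter> J)" if w: "w \<in> ?I" for w
  proof -
    have count: "num_false \<alpha> (image_mset (formula_label P) (mset_set S)) = card (S \<inter> J)"
      if "S \<subseteq> formula_verts P" for S
    proof -
      have "{u \<in> S. \<not> satisfies \<alpha> (formula_label P u)} = S \<inter> J"
        using that J by blast
      then show ?thesis
        using finite_subset[OF that finV] by (simp add: num_false_image_mset_set)
    qed
    have "inference_label P w \<in> axiom_rule \<union> symmetric_cut_rule \<union> split_rule"
      and "prems_of (inference_label P w) = image_mset (formula_label P) (mset_set (in_nbrs P w))"
      and "concls_of (inference_label P w) = image_mset (formula_label P) (mset_set (out_nbrs P w))"
      using pre w unfolding circular_pre_proof_def by blast+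
    then show ?thesis
      using num_false_prems_eq_concls[of "inference_label P w" \<alpha>] count nbrs[OF w] by simp
  qed
  moreover have "in_nbrs P u \<subseteq> ?I" "out_nbrs P u \<subseteq> ?I" if "u \<in> J" for u
    using arcs verts(2) that J by (auto simp: in_nbrs_def out_nbrs_def)
  ultimately show "(\<Sum>u\<in>J. balance P F u) = 0"
    using sum_balance[OF finI finJ] by simp
qed

theorem theorem1:
  fixes \<R> :: "'v rule set"
    and P :: "('u, 'v) labelled_graph"
    and H :: "'v formula set"
    and A :: "'v formula"
  assumes "\<R> = {axiom_rule, symmetric_cut_rule, split_rule}"
    and "circular_proof \<R> P H A"
  shows "\<forall>\<alpha> :: 'v \<Rightarrow> bool. (\<forall>B \<in> H. satisfies \<alpha> B) \<longrightarrow> satisfies \<alpha> A"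
proof (intro allI impI, rule ccontr)
  fix \<alpha> :: "'v \<Rightarrow> bool"
  assume hyps: "\<forall>B \<in> H. satisfies \<alpha> B" and false: "\<not> satisfies \<alpha> A"
  obtain F where pre: "circular_pre_proof {axiom_rule, symmetric_cut_rule, split_rule} P"
    and wit: "witnesses_proof P F H A"
    using assms by (auto simp: circular_proof_def)
  define J where "J = {u \<in> formula_verts P. \<not> satisfies \<alpha> (formula_label P u)}"
  have nonneg: "0 \<le> balance P F u" if "u \<in> J" for u
    using wit hyps that by (force simp: witnesses_proof_def sources_def J_def)
  \<comment> \<open>The witness is the sink labelled \<open>A\<close>; it lies in \<open>J\<close>
    because \<open>A\<close> is assumed false under \<alpha>.\<close>
  obtain u where "u \<in> J" and pos: "0 < balance P F u"
    using wit false by (auto simp: witnesses_proof_def sinks_def J_def)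
  have "balance P F u = 0"
    using sum_nonneg_eq_0_iff[of J "balance P F"] sum_balance_false_eq_0[OF pre J_def]
      nonneg \<open>u \<in> J\<close> by blast
  with pos show False by simp
qed

end
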